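(* Let $I,J\subseteq\mathbb R$ be open intervals, let $a:I\to\mathbb R$ and $b_1,b_2:J\to\mathbb R$ be arbitrary continuous functions and let $z$ be a nonzero real number. Put $$\Xi(x):=\exp\left(-\int^x a(\xi)\,\mathrm d\xi\right),\qquad \omega=\frac{\Xi(x)}{y}\,\mathrm dx\wedge\mathrm dy\quad\text{on } I\times(\mathbb R\setminus\{0\}).$$ (i) The deformation of the $t$-dependent extended generalized Buchdahl Hamiltonian $h_t=h_1+b_1(t)h_2+b_2(t)h_3$, with $h_1=y\,\Xi(x)$, $h_2=-\int^x\Xi(\xi)\,\mathrm d\xi$, $h_3=\frac{1}{y\,\Xi(x)}\int^x\Xi(\xi)\,\mathrm d\xi$ (the deformation being defined by the change of variables described in the context), is given in terms of the variables $(x,y)$ by $$\begin{aligned} h_{z,t}&=h_{z,1}+b_1(t)h_{z,2}+b_2(t)h_{z,3},\qquad h_{z,1}=y\,\Xi(x),\\ h_{z,2}&=\frac{\exp\bigl(-zy\,\Xi(x)\bigr)-1}{zy\,\Xi(x)}\int^x\Xi(\xi)\,\mathrm d\xi,\qquad h_{z,3}=\frac{\exp\bigl(-zy\,\Xi(x)\bigr)}{y\,\Xi(x)}\int^x\Xi(\xi)\,\mathrm d\xi, \end{aligned}$$ and these functions together with $h_{z,0}=1$ satisfy $$\{h_{z,2},h_{z,1}\}_\omega=\frac{\mathrm e^{-zh_{z,1}}-1}{z},\quad \{h_{z,2},h_{z,3}\}_\omega=h_{z,3},\quad \{h_{z,3},h_{z,1}\}_\omega=\mathrm e^{-zh_{z,1}}h_{z,0},\quad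 \{h_{z,0},\,\cdot\,\}_\omega=0.$$ (ii) The corresponding Poisson--Hopf deformation of the extended generalized Buchdahl system, i.e. the system of Hamilton equations of $h_{z,t}$ with respect to $\omega$, is $$\begin{aligned} \frac{\mathrm dx}{\mathrm dt}=\{x,h_{z,t}\}_\omega&=y+b_1(t)\left(\frac{\exp\bigl(zy\,\Xi(x)\bigr)-1-zy\,\Xi(x)}{zy\,\Xi^2(x)}\right)\exp\bigl(-zy\,\Xi(x)\bigr)\int^x\Xi(\xi)\,\mathrm d\xi\\ &\quad-b_2(t)\left(\frac{1+zy\,\Xi(x)}{y\,\Xi^2(x)}\right)\exp\bigl(-zy\,\Xi(x)\bigr)\int^x\Xi(\xi)\,\mathrm d\xi,\\ \frac{\mathrm dy}{\mathrm dt}=\{y,h_{z,t}\}_\omega&=a(x)y^2+b_1(t)\exp\bigl(-zy\,\Xi(x)\bigr)\\ &\quad\times\left(\frac{\exp\bigl(zy\,\Xi(x)\bigr)-1}{z\,\Xi(x)}+\frac{\exp\bigl(zy\,\Xi(x)\bigr)-1-zy\,\Xi(x)}{z\,\Xi^2(x)}\,a(x)\int^x\Xi(\xi)\,\mathrm d\xi\right)\\ &\quad-b_2(t)\,\frac{\exp\bigl(-zy\,\Xi(x)\bigr)}{\Xi^2(x)}\left(\Xi(x)+\bigl(1+zy\,\Xi(x)\bigr)a(x)\int^x\Xi(\xi)\,\mathrm d\xi\right). \end{aligned}$$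
   Context: Indefinite integrals $\int^x(\cdot)\,\mathrm d\xi$ denote antiderivatives of the integrand, chosen once and for all; thus $\Xi>0$ and $\Xi'=-a\,\Xi$. The Poisson bracket of $\omega$ is $$\{f,g\}_\omega=\frac{y}{\Xi(x)}\left(\frac{\partial f}{\partial x}\frac{\partial g}{\partial y}-\frac{\partial f}{\partial y}\frac{\partial g}{\partial x}\right),\qquad y\neq0.$$ Definition of the deformation. In canonical coordinates $(q,p)$ with $\omega_{\rm can}=\mathrm dq\wedge\mathrm dp$, the non-standard quantum oscillator algebra $\mathfrak h_{z,4}$ (generators $v_1,v_2,v_3,v_0$ with $[v_2,v_1]_z=(\mathrm e^{-zv_1}-1)/z$, $[v_2,v_3]_z=v_3$, $[v_3,v_1]_z=\mathrm e^{-zv_1}v_0$, $v_0$ central) is represented by the functions $$h_{z,1}=-q,\qquad h_{z,2}=\frac{\mathrm e^{zq}-1}{z}\,p,\qquad h_{z,3}=\mathrm e^{zq}p,\qquad h_{z,0}=1,$$ which for $z\to0$ become $h_1=-q$, $h_2=qp$, $h_3=p$, $h_0=1$. The deformed functions in the variables $(x,y)$ are those obtained from these by the change of variables $$q=-y\,\Xi(x),\qquad p=\frac{1}{y\,\Xi(x)}\int^x\Xi(\xi)\,\mathrm d\xi,$$ under which $\mathrm dq\wedge\mathrm dp$ becomes $\omega$. The undeformed extended generalized Buchdahl system is the system of Hamilton equations of $h_t$ with respect to $\omega$. *)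

theory Defs
  imports "HOL-Analysis.Analysis"
begin

text \<open>Throughout, \<open>A\<close> stands for the chosen antiderivative of \<open>a\<close> and \<open>F\<close> for the chosen
  antiderivative of \<open>Xi A\<close>; both are parameters of the definitions. A 2-form on (an open subset
  of) the plane is a point-dependent bilinear form, and \<open>dx \<and> dy\<close> maps \<open>(u, v)\<close> to
  \<open>fst u * snd v - snd u * fst v\<close>.\<close>

type_synonym two_form = "real \<times> real \<Rightarrow> real \<times> real \<Rightarrow> real \<times> real \<Rightarrow> real"

definition phase_space :: "real set \<Rightarrow> (real \<times> real) set" where
  "phase_space I = I \<times> (- {0})"

definition Xi :: "(real \<Rightarrow> real) \<Rightarrow> real \<Rightarrow> real" where
  "Xi A x = exp (- A x)"

definition omega :: "(real \<Rightarrow> real) \<Rightarrow> two_form" where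
  "omega A = (\<lambda>(x, y) u v. Xi A x / y * (fst u * snd v - snd u * fst v))"

definition omega_can :: two_form where
  "omega_can = (\<lambda>_ u v. fst u * snd v - snd u * fst v)"

definition pullback :: "(real \<times> real \<Rightarrow> real \<times> real) \<Rightarrow> two_form \<Rightarrow> two_form" where
  "pullback \<phi> \<sigma> = (\<lambda>P u v. \<sigma> (\<phi> P) (frechet_derivative \<phi> (at P) u) (frechet_derivative \<phi> (at P) v))"

definition poisson_bracket ::
  "(real \<Rightarrow> real) \<Rightarrow> (real \<times> real \<Rightarrow> real) \<Rightarrow> (real \<times> real \<Rightarrow> real) \<Rightarrow> real \<times> real \<Rightarrow> real" where
  "poisson_bracket A f g = (\<lambda>(x, y). y / Xi A x *
     (deriv (\<lambda>s. f (s, y)) x * deriv (\<lambda>s. g (x, s)) y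
      - deriv (\<lambda>s. f (x, s)) y * deriv (\<lambda>s. g (s, y)) x))"

text \<open>Hamilton equations of a time-dependent Hamiltonian \<open>h\<close> with respect to a 2-form \<open>\<sigma>\<close>, with
  the sign convention \<open>\<iota>\<^sub>X \<sigma> = dh\<close> for the Hamiltonian vector field. For \<open>\<sigma> = omega A\<close> this is the
  convention under which the equations read \<open>dx/dt = {x, h}\<close> and \<open>dy/dt = {y, h}\<close> for
  \<^const>\<open>poisson_bracket\<close>.\<close>

definition hamilton_solution ::
  "two_form \<Rightarrow> (real \<Rightarrow> real \<times> real \<Rightarrow> real) \<Rightarrow> real set \<Rightarrow> (real \<Rightarrow> real \<times> real) \<Rightarrow> bool" where
  "hamilton_solution \<sigma> h T \<gamma> \<longleftrightarrow>
     (\<forall>t\<in>T. h t differentiable (at (\<gamma> t)) \<and>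
       (\<exists>X. (\<gamma> has_vector_derivative X) (at t) \<and>
            (\<forall>v. \<sigma> (\<gamma> t) X v = frechet_derivative (h t) (at (\<gamma> t)) v)))"

text \<open>The undeformed functions and the functions representing the quantum oscillator algebra,
  both in canonical coordinates \<open>(q, p)\<close>; \<open>can_coords\<close> maps \<open>(x, y)\<close> to \<open>(q, p)\<close>.\<close>

definition osc1 :: "real \<times> real \<Rightarrow> real" where "osc1 = (\<lambda>(q, p). - q)"
definition osc2 :: "real \<times> real \<Rightarrow> real" where "osc2 = (\<lambda>(q, p). q * p)"
definition osc3 :: "real \<times> real \<Rightarrow> real" where "osc3 = (\<lambda>(q, p). p)"

definition oscz1 :: "real \<Rightarrow> real \<times> real \<Rightarrow> real" where
  "oscz1 z = (\<lambda>(q, p). - q)"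
definition oscz2 :: "real \<Rightarrow> real \<times> real \<Rightarrow> real" where
  "oscz2 z = (\<lambda>(q, p). (exp (z * q) - 1) / z * p)"
definition oscz3 :: "real \<Rightarrow> real \<times> real \<Rightarrow> real" where
  "oscz3 z = (\<lambda>(q, p). exp (z * q) * p)"
definition oscz0 :: "real \<Rightarrow> real \<times> real \<Rightarrow> real" where
  "oscz0 z = (\<lambda>(q, p). 1)"

definition can_coords :: "(real \<Rightarrow> real) \<Rightarrow> (real \<Rightarrow> real) \<Rightarrow> real \<times> real \<Rightarrow> real \<times> real" where
  "can_coords A F = (\<lambda>(x, y). (- y * Xi A x, 1 / (y * Xi A x) * F x))"

lemma pullback_omega_can:
  assumes A: "(A has_real_derivative a x) (at x)"
    and F: "(F has_real_derivative Xi A x) (at x)"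
    and y: "y \<noteq> 0"
  shows "pullback (can_coords A F) omega_can (x, y) = omega A (x, y)"
proof -
  let ?X = "Xi A x"
  have A': "(A has_derivative (\<lambda>h. h * a x)) (at (fst (x, y)))"
    using A by (simp add: has_field_derivative_def mult_commute_abs)
  have F': "(F has_derivative (\<lambda>h. h * ?X)) (at (fst (x, y)))"
    using F by (simp add: has_field_derivative_def mult_commute_abs)
  have fst': "(fst has_derivative fst) (at (x, y))"
    and snd': "(snd has_derivative snd) (at (x, y))"
    by (auto intro!: derivative_eq_intros)
  note AA = has_derivative_compose[OF fst' A'] and FF = has_derivative_compose[OF fst' F']
  have X: "?X \<noteq> 0" by (simp add: Xi_def)
  have XX: "((\<lambda>P. Xi A (fst P)) has_derivative (\<lambda>u. - a x * ?X * fst u)) (at (x, y))"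
    unfolding Xi_def by (rule derivative_eq_intros AA refl | simp add: algebra_simps)+
  have eq: "can_coords A F =
      (\<lambda>P. (- snd P * Xi A (fst P), 1 / (snd P * Xi A (fst P)) * F (fst P)))"
    by (auto simp: can_coords_def)
  have der1: "((\<lambda>P. - snd P * Xi A (fst P)) has_derivative
      (\<lambda>u. a x * y * ?X * fst u - ?X * snd u)) (at (x, y))"
    by (rule has_derivative_eq_rhs, rule has_derivative_mult[OF has_derivative_minus[OF snd'] XX])
      (simp add: fun_eq_iff algebra_simps)
  have den: "((\<lambda>P. snd P * Xi A (fst P)) has_derivative
      (\<lambda>u. ?X * snd u - a x * y * ?X * fst u)) (at (x, y))"
    by (rule has_derivative_eq_rhs, rule has_derivative_mult[OF snd' XX])
      (simp add: fun_eq_iff algebra_simps)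
  have nz: "snd (x, y) * Xi A (fst (x, y)) \<noteq> 0"
    using X y by simp
  have der2: "((\<lambda>P. F (fst P) / (snd P * Xi A (fst P))) has_derivative
      (\<lambda>u. (1 / y + a x * F x / (y * ?X)) * fst u - F x / (y * y * ?X) * snd u)) (at (x, y))"
    by (rule has_derivative_eq_rhs, rule has_derivative_divide'[OF FF den nz])
      (use X y in \<open>simp add: fun_eq_iff field_simps\<close>)
  have "(can_coords A F has_derivative
      (\<lambda>u. (a x * y * ?X * fst u - ?X * snd u,
        (1 / y + a x * F x / (y * ?X)) * fst u - F x / (y * y * ?X) * snd u))) (at (x, y))"
    unfolding eq using has_derivative_Pair[OF der1 der2] by simp
  then have fd: "frechet_derivative (can_coords A F) (at (x, y)) =
      (\<lambda>u. (a x * y * ?X * fst u - ?X * snd u,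
        (1 / y + a x * F x / (y * ?X)) * fst u - F x / (y * y * ?X) * snd u))"
    by (rule frechet_derivative_at[symmetric])
  have "pullback (can_coords A F) omega_can (x, y) u v = omega A (x, y) u v" for u v
    using X y by (simp add: pullback_def fd omega_can_def omega_def field_simps)
  then show ?thesis by blast
qed

definition buch1 :: "(real \<Rightarrow> real) \<Rightarrow> (real \<Rightarrow> real) \<Rightarrow> real \<times> real \<Rightarrow> real" where
  "buch1 A F = (\<lambda>(x, y). y * Xi A x)"
definition buch2 :: "(real \<Rightarrow> real) \<Rightarrow> (real \<Rightarrow> real) \<Rightarrow> real \<times> real \<Rightarrow> real" where
  "buch2 A F = (\<lambda>(x, y). - F x)"
definition buch3 :: "(real \<Rightarrow> real) \<Rightarrow> (real \<Rightarrow> real) \<Rightarrow> real \<times> real \<Rightarrow> real" where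
  "buch3 A F = (\<lambda>(x, y). 1 / (y * Xi A x) * F x)"

definition buch_ham ::
  "(real \<Rightarrow> real) \<Rightarrow> (real \<Rightarrow> real) \<Rightarrow> (real \<Rightarrow> real) \<Rightarrow> (real \<Rightarrow> real) \<Rightarrow> real \<Rightarrow> real \<times> real \<Rightarrow> real" where
  "buch_ham A F b1 b2 t P = buch1 A F P + b1 t * buch2 A F P + b2 t * buch3 A F P"

definition hz1 :: "(real \<Rightarrow> real) \<Rightarrow> (real \<Rightarrow> real) \<Rightarrow> real \<Rightarrow> real \<times> real \<Rightarrow> real" where
  "hz1 A F z = oscz1 z \<circ> can_coords A F"
definition hz2 :: "(real \<Rightarrow> real) \<Rightarrow> (real \<Rightarrow> real) \<Rightarrow> real \<Rightarrow> real \<times> real \<Rightarrow> real" where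
  "hz2 A F z = oscz2 z \<circ> can_coords A F"
definition hz3 :: "(real \<Rightarrow> real) \<Rightarrow> (real \<Rightarrow> real) \<Rightarrow> real \<Rightarrow> real \<times> real \<Rightarrow> real" where
  "hz3 A F z = oscz3 z \<circ> can_coords A F"
definition hz0 :: "(real \<Rightarrow> real) \<Rightarrow> (real \<Rightarrow> real) \<Rightarrow> real \<Rightarrow> real \<times> real \<Rightarrow> real" where
  "hz0 A F z = oscz0 z \<circ> can_coords A F"

definition deformed_ham ::
  "(real \<Rightarrow> real) \<Rightarrow> (real \<Rightarrow> real) \<Rightarrow> (real \<Rightarrow> real) \<Rightarrow> (real \<Rightarrow> real) \<Rightarrow> real \<Rightarrow> real \<Rightarrow> real \<times> real \<Rightarrow> real" where
  "deformed_ham A F b1 b2 z t =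
     (\<lambda>(q, p). oscz1 z (q, p) + b1 t * oscz2 z (q, p) + b2 t * oscz3 z (q, p)) \<circ> can_coords A F"

end

theory Submission
  imports Defs
begin

text \<open>All functions involved have the form \<open>\<psi>(r) + \<phi>(r) F(x)\<close> with \<open>r = y \<Xi>(x)\<close>. As
  \<open>\<Xi>' = - a \<Xi>\<close> and \<open>F' = \<Xi>\<close>, the partial derivatives of such a function are
  \<open>\<phi>(r) \<Xi> - a r (\<psi>'(r) + \<phi>'(r) F)\<close> and \<open>\<Xi> (\<psi>'(r) + \<phi>'(r) F)\<close>; the brackets and the
  Hamilton equations follow by substituting the two profiles
  \<open>\<phi>(r) = (exp (- z r) - 1) / (z r)\<close> and \<open>\<phi>(r) = exp (- z r) / r\<close>.\<close>

section \<open>Gradients of functions of \<open>r = y * Xi A x\<close> and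
  \<open>F x\<close>\<close>

lemma Xi_neq_0 [simp]: "Xi A x \<noteq> 0"
  by (simp add: Xi_def)

text \<open>Since \<open>Xi' = - a * Xi\<close>, one has dr = Xi dy - a r dx, so the differential is
  (psi' + phi' F) dr + phi Xi dx, the last term coming from F' = Xi. A total derivative is recorded
  rather than two partial ones because \<open>hamilton_solution\<close> asks for differentiability
  in the plane.\<close>

lemma has_derivative_profile:
  assumes A: "(A has_real_derivative a) (at x)"
    and F: "(F has_real_derivative Xi A x) (at x)"
    and \<psi>: "(\<psi> has_real_derivative \<psi>') (at (y * Xi A x))"
    and \<phi>: "(\<phi> has_real_derivative \<phi>') (at (y * Xi A x))"
  shows "((\<lambda>P. \<psi> (snd P * Xi A (fst P)) + \<phi> (snd P * Xi A (fst P)) * F (fst P)) has_derivative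
    (\<lambda>u. (\<phi> (y * Xi A x) * Xi A x - a * (y * Xi A x) * (\<psi>' + \<phi>' * F x)) * fst u
       + Xi A x * (\<psi>' + \<phi>' * F x) * snd u)) (at (x, y))"
proof -
  have fst': "(fst has_derivative fst) (at (x, y))"
    and snd': "(snd has_derivative snd) (at (x, y))"
    by (auto intro!: derivative_eq_intros)
  have Xi: "(Xi A has_real_derivative - a * Xi A x) (at x)"
    unfolding Xi_def by (rule derivative_eq_intros A refl | simp)+
  have XX: "((\<lambda>P. Xi A (fst P)) has_derivative (\<lambda>u. (- a * Xi A x) * fst u)) (at (x, y))"
    by (rule has_derivative_compose[OF fst', of "Xi A" "(*) (- a * Xi A x)"])
      (use Xi in \<open>simp add: has_field_derivative_def\<close>)
  have FF: "((\<lambda>P. F (fst P)) has_derivative (\<lambda>u. Xi A x * fst u)) (at (x, y))"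
    by (rule has_derivative_compose[OF fst', of F "(*) (Xi A x)"])
      (use F in \<open>simp add: has_field_derivative_def\<close>)
  have r: "((\<lambda>P. snd P * Xi A (fst P)) has_derivative
      (\<lambda>u. Xi A x * snd u - a * (y * Xi A x) * fst u)) (at (x, y))"
    by (rule has_derivative_eq_rhs, rule has_derivative_mult[OF snd' XX])
      (simp add: fun_eq_iff algebra_simps)
  have P: "((\<lambda>P. \<psi> (snd P * Xi A (fst P))) has_derivative
      (\<lambda>u. \<psi>' * (Xi A x * snd u - a * (y * Xi A x) * fst u))) (at (x, y))"
    by (rule has_derivative_compose[OF r, of \<psi> "(*) \<psi>'"])
      (use \<psi> in \<open>simp add: has_field_derivative_def\<close>)
  have Q: "((\<lambda>P. \<phi> (snd P * Xi A (fst P))) has_derivative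
      (\<lambda>u. \<phi>' * (Xi A x * snd u - a * (y * Xi A x) * fst u))) (at (x, y))"
    by (rule has_derivative_compose[OF r, of \<phi> "(*) \<phi>'"])
      (use \<phi> in \<open>simp add: has_field_derivative_def\<close>)
  show ?thesis
    by (rule has_derivative_eq_rhs, rule has_derivative_add[OF P has_derivative_mult[OF Q FF]])
      (simp add: fun_eq_iff algebra_simps)
qed

section \<open>Brackets and Hamilton equations from total derivatives\<close>

lemma deriv_partials:
  fixes f :: "real \<times> real \<Rightarrow> real"
  assumes "(f has_derivative (\<lambda>u. p * fst u + q * snd u)) (at (x, y))"
  shows "deriv (\<lambda>s. f (s, y)) x = p" "deriv (\<lambda>s. f (x, s)) y = q"
proof -
  \<comment> \<open>The bracket is built from \<open>deriv\<close> along coordinate lines; composing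
    the total derivative with the embedding of such a line isolates one coefficient.\<close>
  have "((\<lambda>s. (s, y)) has_derivative (\<lambda>h. (h, 0))) (at x)"
    by (auto intro!: derivative_eq_intros)
  from has_derivative_compose[OF this assms]
  show "deriv (\<lambda>s. f (s, y)) x = p"
    by (intro DERIV_imp_deriv) (simp add: has_field_derivative_def)
  have "((\<lambda>s. (x, s)) has_derivative (\<lambda>h. (0, h))) (at y)"
    by (auto intro!: derivative_eq_intros)
  from has_derivative_compose[OF this assms]
  show "deriv (\<lambda>s. f (x, s)) y = q"
    by (intro DERIV_imp_deriv) (simp add: has_field_derivative_def)
qed

lemma poisson_bracket_partials:
  assumes "(f has_derivative (\<lambda>u. p * fst u + q * snd u)) (at (x, y))"
    and "(g has_derivative (\<lambda>u. p' * fst u + q' * snd u)) (at (x, y))"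
  shows "poisson_bracket A f g (x, y) = y / Xi A x * (p * q' - q * p')"
  by (simp add: poisson_bracket_def deriv_partials[OF assms(1)] deriv_partials[OF assms(2)])

lemma poisson_bracket_coordinates:
  assumes "(h has_derivative (\<lambda>u. p * fst u + q * snd u)) (at (x, y))"
  shows "poisson_bracket A fst h (x, y) = y / Xi A x * q"
    and "poisson_bracket A snd h (x, y) = - (y / Xi A x * p)"
proof -
  have "(fst has_derivative (\<lambda>u. 1 * fst u + 0 * snd u)) (at (x, y))"
    by (auto intro!: derivative_eq_intros)
  from poisson_bracket_partials[OF this assms]
  show "poisson_bracket A fst h (x, y) = y / Xi A x * q" by simp
  have "(snd has_derivative (\<lambda>u. 0 * fst u + 1 * snd u)) (at (x, y))"
    by (auto intro!: derivative_eq_intros)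
  from poisson_bracket_partials[OF this assms]
  show "poisson_bracket A snd h (x, y) = - (y / Xi A x * p)" by simp
qed

text \<open>For y \<noteq> 0 the form is nondegenerate: contracting it with X gives (Xi / y) (X1 dy
  - X2 dx), and comparing coefficients with dh determines X1 and X2 uniquely.\<close>

lemma hamilton_vector_omega_iff:
  assumes h: "(h has_derivative (\<lambda>u. p * fst u + q * snd u)) (at (x, y))"
    and y: "y \<noteq> 0"
  shows "(\<forall>v. omega A (x, y) X v = frechet_derivative h (at (x, y)) v) \<longleftrightarrow>
    X = (poisson_bracket A fst h (x, y), poisson_bracket A snd h (x, y))"
    (is "?L \<longleftrightarrow> ?R")
proof -
  have fd: "frechet_derivative h (at (x, y)) = (\<lambda>u. p * fst u + q * snd u)"
    using frechet_derivative_at[OF h] by simp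
  have iff: "?R \<longleftrightarrow> Xi A x / y * fst X = q \<and> - (Xi A x / y * snd X) = p"
    using y by (auto simp: poisson_bracket_coordinates[OF h] prod_eq_iff field_simps)
  have "?L \<longleftrightarrow> (\<forall>v. Xi A x / y * (fst X * snd v - snd X * fst v) = p * fst v + q * snd v)"
    by (simp add: omega_def fd)
  also have "\<dots> \<longleftrightarrow> Xi A x / y * fst X = q \<and> - (Xi A x / y * snd X) = p"
  proof
    assume *: "\<forall>v. Xi A x / y * (fst X * snd v - snd X * fst v) = p * fst v + q * snd v"
    \<comment> \<open>The vector (0, 1) reads off the dy coefficient and (1, 0) the dx
      coefficient.\<close>
    from *[rule_format, of "(0, 1)"] *[rule_format, of "(1, 0)"]
    show "Xi A x / y * fst X = q \<and> - (Xi A x / y * snd X) = p" by simp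
  next
    assume "Xi A x / y * fst X = q \<and> - (Xi A x / y * snd X) = p"
    then have "q = Xi A x / y * fst X" "p = - (Xi A x / y * snd X)" by auto
    then show "\<forall>v. Xi A x / y * (fst X * snd v - snd X * fst v) = p * fst v + q * snd v"
      by (simp add: algebra_simps)
  qed
  finally show ?thesis using iff by simp
qed

text \<open>The claim is pointwise in t: the velocity is forced by the nondegeneracy of
  \<open>omega A\<close>, and a derivative in the plane is a pair of derivatives of the
  components.\<close>

lemma hamilton_solution_omega_iff:
  assumes "\<And>t. t \<in> T \<Longrightarrow> h t differentiable (at (x t, y t))"
    and "\<And>t. t \<in> T \<Longrightarrow> y t \<noteq> 0"
  shows "hamilton_solution (omega A) h T (\<lambda>t. (x t, y t)) \<longleftrightarrow>
    (\<forall>t\<in>T. (x has_real_derivative poisson_bracket A fst (h t) (x t, y t)) (at t) \<and>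
           (y has_real_derivative poisson_bracket A snd (h t) (x t, y t)) (at t))"
proof -
  have "(h t differentiable (at (x t, y t)) \<and>
      (\<exists>X. ((\<lambda>t. (x t, y t)) has_vector_derivative X) (at t) \<and>
        (\<forall>v. omega A (x t, y t) X v = frechet_derivative (h t) (at (x t, y t)) v))) \<longleftrightarrow>
    (x has_real_derivative poisson_bracket A fst (h t) (x t, y t)) (at t) \<and>
    (y has_real_derivative poisson_bracket A snd (h t) (x t, y t)) (at t)"
    (is "?L \<longleftrightarrow> ?R") if t: "t \<in> T" for t
  proof -
    obtain D where D: "(h t has_derivative D) (at (x t, y t))"
      using assms(1)[OF t] by (auto simp: differentiable_def)
    then interpret linear D by (rule has_derivative_linear)
    \<comment> \<open>A linear functional on the plane is fixed by its values on the standard basis;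
      these values serve as the two partial derivatives.\<close>
    have "D u = D (1, 0) * fst u + D (0, 1) * snd u" for u
    proof -
      have "u = fst u *\<^sub>R (1, 0) + snd u *\<^sub>R (0, 1)" by (simp add: prod_eq_iff)
      then have "D u = D (fst u *\<^sub>R (1, 0) + snd u *\<^sub>R (0, 1))" by (rule arg_cong)
      also have "\<dots> = D (1, 0) * fst u + D (0, 1) * snd u"
        by (simp only: add scaleR real_scaleR_def mult.commute)
      finally show ?thesis .
    qed
    then have "D = (\<lambda>u. D (1, 0) * fst u + D (0, 1) * snd u)" by blast
    with D have h: "(h t has_derivative (\<lambda>u. D (1, 0) * fst u + D (0, 1) * snd u)) (at (x t, y t))"
      by simp
    \<comment> \<open>The condition on X is an equation for X, so the existential collapses to this
      single velocity.\<close>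
    have "?L \<longleftrightarrow> ((\<lambda>t. (x t, y t)) has_vector_derivative
        (poisson_bracket A fst (h t) (x t, y t), poisson_bracket A snd (h t) (x t, y t))) (at t)"
      using hamilton_vector_omega_iff[OF h assms(2)[OF t], of A] assms(1)[OF t] by simp
    also have "\<dots> \<longleftrightarrow> ?R"
    proof
      assume *: "((\<lambda>t. (x t, y t)) has_vector_derivative
        (poisson_bracket A fst (h t) (x t, y t), poisson_bracket A snd (h t) (x t, y t))) (at t)"
      from bounded_linear.has_vector_derivative[OF bounded_linear_fst *]
        bounded_linear.has_vector_derivative[OF bounded_linear_snd *]
      show ?R by (simp add: has_real_derivative_iff_has_vector_derivative)
    next
      assume ?R
      then show "((\<lambda>t. (x t, y t)) has_vector_derivative
        (poisson_bracket A fst (h t) (x t, y t), poisson_bracket A snd (h t) (x t, y t))) (at t)"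
        by (auto simp: has_real_derivative_iff_has_vector_derivative
            intro: has_vector_derivative_Pair)
    qed
    finally show ?thesis .
  qed
  then show ?thesis unfolding hamilton_solution_def by blast
qed

section \<open>Explicit deformed functions, their profiles and the undeformed limit\<close>

lemma hz1_eq: "hz1 A F z (x, y) = y * Xi A x"
  by (simp add: hz1_def oscz1_def can_coords_def)

lemma hz2_eq: "hz2 A F z (x, y) = (exp (- z * y * Xi A x) - 1) / (z * y * Xi A x) * F x"
  by (simp add: hz2_def oscz2_def can_coords_def mult.assoc)

lemma hz3_eq: "hz3 A F z (x, y) = exp (- z * y * Xi A x) / (y * Xi A x) * F x"
  by (simp add: hz3_def oscz3_def can_coords_def mult.assoc)

lemma hz0_eq: "hz0 A F z P = 1"
  by (cases P) (simp add: hz0_def oscz0_def can_coords_def)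

lemma deformed_ham_eq:
  "deformed_ham A F b1 b2 z t P = hz1 A F z P + b1 t * hz2 A F z P + b2 t * hz3 A F z P"
  by (simp add: deformed_ham_def hz1_def hz2_def hz3_def case_prod_beta)

lemma DERIV_profile2:
  fixes z r :: real
  assumes "z \<noteq> 0" "r \<noteq> 0"
  shows "((\<lambda>r. (exp (- z * r) - 1) / (z * r)) has_real_derivative
    (1 - exp (- z * r) - z * r * exp (- z * r)) / (z * r\<^sup>2)) (at r)"
  by (rule derivative_eq_intros refl | use assms in
      \<open>simp add: field_simps power2_eq_square\<close>)+

lemma DERIV_profile3:
  fixes z r :: real
  assumes "r \<noteq> 0"
  shows "((\<lambda>r. exp (- z * r) / r) has_real_derivative
    - ((1 + z * r) * exp (- z * r)) / r\<^sup>2) (at r)"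
  by (rule derivative_eq_intros refl | use assms in
      \<open>simp add: field_simps power2_eq_square\<close>)+

text \<open>Only the \<open>hz2\<close> term is singular at w = 0. There (exp (- w r) - 1) / w is
  the difference quotient of w |-> exp (- w r) at 0, with limit - r, and - r * (F / r) = - F is
  \<open>buch2\<close>. The \<open>hz3\<close> term is continuous in w.\<close>

lemma tendsto_deformed_ham:
  assumes "snd P \<noteq> 0"
  shows "((\<lambda>w. deformed_ham A F b1 b2 w t P) \<longlongrightarrow> buch_ham A F b1 b2 t P) (at 0)"
proof (cases P)
  case (Pair x y)
  let ?r = "y * Xi A x"
  have r: "?r \<noteq> 0" using assms Pair by simp
  have "((\<lambda>w. exp (- w * ?r)) has_real_derivative - ?r) (at 0)"
    by (rule derivative_eq_intros refl | simp)+
  then have lim: "((\<lambda>w. (exp (- w * ?r) - 1) / w) \<longlongrightarrow> - ?r) (at 0)"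
    by (simp add: has_field_derivative_iff)
  \<comment> \<open>The factor F / r does not depend on w and is split off so that the difference
    quotient stands alone.\<close>
  have "((\<lambda>w. ?r + b1 t * ((exp (- w * ?r) - 1) / w * (F x / ?r))
      + b2 t * (exp (- w * ?r) / ?r * F x)) \<longlongrightarrow>
    ?r + b1 t * (- ?r * (F x / ?r)) + b2 t * (exp (- 0 * ?r) / ?r * F x)) (at 0)"
    by (intro tendsto_intros lim r)
  then show ?thesis
    using r unfolding Pair deformed_ham_eq hz1_eq hz2_eq hz3_eq
    by (simp add: buch_ham_def buch1_def buch2_def buch3_def mult.assoc)
qed

section \<open>Gradients and brackets of the deformed functions at a fixed point\<close>

context
  fixes A F :: "real \<Rightarrow> real" and a x y z :: real
  assumes A: "(A has_real_derivative a) (at x)"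
    and F: "(F has_real_derivative Xi A x) (at x)"
    and y: "y \<noteq> 0" and z: "z \<noteq> 0"
begin

text \<open>In this context \<open>a\<close> is a number, the derivative of \<open>A\<close> at the
  fixed \<open>x\<close>. The profiles are psi(r) = r and phi = 0.\<close>

lemma has_derivative_hz1:
  "(hz1 A F z has_derivative (\<lambda>u. - (a * y * Xi A x) * fst u + Xi A x * snd u)) (at (x, y))"
proof -
  have eq: "hz1 A F z = (\<lambda>P. snd P * Xi A (fst P) + 0 * F (fst P))"
    by (auto simp: hz1_eq)
  show ?thesis unfolding eq
    by (rule has_derivative_eq_rhs, rule has_derivative_profile[OF A F DERIV_ident DERIV_const])
      (simp add: fun_eq_iff)
qed

lemma has_derivative_hz2:
  "(hz2 A F z has_derivative
    (\<lambda>u. ((exp (- z * y * Xi A x) - 1) / (z * y)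
        - a * F x * (1 - exp (- z * y * Xi A x) - z * y * Xi A x * exp (- z * y * Xi A x))
          / (z * y * Xi A x)) * fst u
      + F x * (1 - exp (- z * y * Xi A x) - z * y * Xi A x * exp (- z * y * Xi A x))
          / (z * y\<^sup>2 * Xi A x) * snd u)) (at (x, y))"
proof -
  have r: "y * Xi A x \<noteq> 0" using y by simp
  \<comment> \<open>The leading 0 is the profile psi = 0, which brings the function into the shape
    required by \<open>has_derivative_profile\<close>.\<close>
  have eq: "hz2 A F z = (\<lambda>P. 0 + (exp (- z * (snd P * Xi A (fst P))) - 1)
      / (z * (snd P * Xi A (fst P))) * F (fst P))"
    by (auto simp: hz2_eq mult.assoc)
  show ?thesis unfolding eq
    by (rule has_derivative_eq_rhs,
        rule has_derivative_profile[OF A F DERIV_const DERIV_profile2[OF z r]])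
      (use y z in \<open>simp add: fun_eq_iff field_simps power2_eq_square\<close>)
qed

lemma has_derivative_hz3:
  "(hz3 A F z has_derivative
    (\<lambda>u. (exp (- z * y * Xi A x) / y
        + a * F x * (1 + z * y * Xi A x) * exp (- z * y * Xi A x) / (y * Xi A x)) * fst u
      + - (F x * (1 + z * y * Xi A x) * exp (- z * y * Xi A x) / (y\<^sup>2 * Xi A x)) * snd u))
    (at (x, y))"
proof -
  have r: "y * Xi A x \<noteq> 0" using y by simp
  have eq: "hz3 A F z = (\<lambda>P. 0 + exp (- z * (snd P * Xi A (fst P)))
      / (snd P * Xi A (fst P)) * F (fst P))"
    by (auto simp: hz3_eq mult.assoc)
  show ?thesis unfolding eq
    by (rule has_derivative_eq_rhs,
        rule has_derivative_profile[OF A F DERIV_const DERIV_profile3[OF r]])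
      (use y in \<open>simp add: fun_eq_iff field_simps power2_eq_square\<close>)
qed

lemma has_derivative_deformed_ham:
  "(deformed_ham A F b1 b2 z t has_derivative
    (\<lambda>u. (- (a * y * Xi A x)
        + b1 t * ((exp (- z * y * Xi A x) - 1) / (z * y)
          - a * F x * (1 - exp (- z * y * Xi A x) - z * y * Xi A x * exp (- z * y * Xi A x))
            / (z * y * Xi A x))
        + b2 t * (exp (- z * y * Xi A x) / y
          + a * F x * (1 + z * y * Xi A x) * exp (- z * y * Xi A x) / (y * Xi A x))) * fst u
      + (Xi A x
        + b1 t * (F x * (1 - exp (- z * y * Xi A x) - z * y * Xi A x * exp (- z * y * Xi A x))
            / (z * y\<^sup>2 * Xi A x))
        - b2 t * (F x * (1 + z * y * Xi A x) * exp (- z * y * Xi A x) / (y\<^sup>2 * Xi A x))) * snd u))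
    (at (x, y))"
proof -
  have eq: "deformed_ham A F b1 b2 z t =
      (\<lambda>P. hz1 A F z P + b1 t * hz2 A F z P + b2 t * hz3 A F z P)"
    by (simp add: fun_eq_iff deformed_ham_eq)
  show ?thesis unfolding eq
    by (rule has_derivative_eq_rhs,
        rule has_derivative_add[OF has_derivative_add[OF has_derivative_hz1
            has_derivative_mult_right[OF has_derivative_hz2]]
            has_derivative_mult_right[OF has_derivative_hz3]])
      \<comment> \<open>The two sides differ by regrouping alone, so ring laws suffice and no
        denominator is cleared.\<close>
      (simp only: fun_eq_iff ring_distribs mult.assoc minus_mult_left[symmetric] diff_conv_add_uminus
        ac_simps mult_minus_right simp_thms)
qed

text \<open>All terms containing \<open>a\<close> cancel. For a profile phi, {phi(r) F, r} = r
  phi(r), which gives the two brackets with \<open>hz1\<close>. For the profiles phi2, phi3 of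
  \<open>hz2\<close> and \<open>hz3\<close>, the bracket is r F (phi2 phi3' - phi2' phi3). As phi2 /
  phi3 = (1 - exp (z r)) / z has derivative - exp (z r), this Wronskian equals phi3^2 exp (z r) =
  phi3 / r, and the bracket is phi3 F.\<close>

lemma brackets_hz:
  shows "poisson_bracket A (hz2 A F z) (hz1 A F z) (x, y) = (exp (- z * hz1 A F z (x, y)) - 1) / z"
    and "poisson_bracket A (hz2 A F z) (hz3 A F z) (x, y) = hz3 A F z (x, y)"
    and "poisson_bracket A (hz3 A F z) (hz1 A F z) (x, y) = exp (- z * hz1 A F z (x, y))"
  unfolding poisson_bracket_partials[OF has_derivative_hz2 has_derivative_hz1]
    poisson_bracket_partials[OF has_derivative_hz2 has_derivative_hz3]
    poisson_bracket_partials[OF has_derivative_hz3 has_derivative_hz1] hz1_eq hz3_eq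
  using y z by (simp_all add: field_simps power2_eq_square)

end

section \<open>Assembly of the pointwise results over \<open>phase_space I\<close>\<close>

theorem proposition7p1:
  fixes I J :: "real set" and a b1 b2 A F :: "real \<Rightarrow> real" and z :: real
  assumes "open I" "is_interval I" "I \<noteq> {}"
    and "open J" "is_interval J" "J \<noteq> {}"
    and "continuous_on I a" "continuous_on J b1" "continuous_on J b2"
    and "z \<noteq> 0"
    and A: "\<forall>x\<in>I. (A has_real_derivative a x) (at x)"
    and F: "\<forall>x\<in>I. (F has_real_derivative Xi A x) (at x)"
  shows
    \<comment> \<open>the Buchdahl Hamiltonian in canonical coordinates, and as the limit of its deformation\<close>
    "(\<forall>t\<in>J. \<forall>P\<in>phase_space I.
        buch_ham A F b1 b2 t P =
          (\<lambda>Q. osc1 Q + b1 t * osc2 Q + b2 t * osc3 Q) (can_coords A F P) \<and>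
        ((\<lambda>w. deformed_ham A F b1 b2 w t P) \<longlongrightarrow> buch_ham A F b1 b2 t P) (at 0)) \<and>
    \<comment> \<open>the deformed Hamiltonian in the variables (x, y)\<close>
    (\<forall>t\<in>J. \<forall>P\<in>phase_space I.
        deformed_ham A F b1 b2 z t P = hz1 A F z P + b1 t * hz2 A F z P + b2 t * hz3 A F z P) \<and>
    (\<forall>x\<in>I. \<forall>y. y \<noteq> 0 \<longrightarrow>
        hz1 A F z (x, y) = y * Xi A x \<and>
        hz2 A F z (x, y) = (exp (- z * y * Xi A x) - 1) / (z * y * Xi A x) * F x \<and>
        hz3 A F z (x, y) = exp (- z * y * Xi A x) / (y * Xi A x) * F x \<and>
        hz0 A F z (x, y) = 1) \<and>
    \<comment> \<open>Poisson brackets\<close>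
    (\<forall>P\<in>phase_space I.
        poisson_bracket A (hz2 A F z) (hz1 A F z) P = (exp (- z * hz1 A F z P) - 1) / z \<and>
        poisson_bracket A (hz2 A F z) (hz3 A F z) P = hz3 A F z P \<and>
        poisson_bracket A (hz3 A F z) (hz1 A F z) P = exp (- z * hz1 A F z P) * hz0 A F z P \<and>
        (\<forall>f. f differentiable_on phase_space I \<longrightarrow> poisson_bracket A (hz0 A F z) f P = 0)) \<and>
    \<comment> \<open>Hamilton equations\<close>
    (\<forall>T x y. open T \<and> is_interval T \<and> T \<subseteq> J \<and> (\<forall>t\<in>T. (x t, y t) \<in> phase_space I) \<longrightarrow>
        (hamilton_solution (omega A) (deformed_ham A F b1 b2 z) T (\<lambda>t. (x t, y t)) \<longleftrightarrow>
         (\<forall>t\<in>T.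
            (x has_real_derivative poisson_bracket A fst (deformed_ham A F b1 b2 z t) (x t, y t)) (at t) \<and>
            (y has_real_derivative poisson_bracket A snd (deformed_ham A F b1 b2 z t) (x t, y t)) (at t)))) \<and>
    (\<forall>t\<in>J. \<forall>x\<in>I. \<forall>y. y \<noteq> 0 \<longrightarrow>
        poisson_bracket A fst (deformed_ham A F b1 b2 z t) (x, y) =
          y
          + b1 t * ((exp (z * y * Xi A x) - 1 - z * y * Xi A x) / (z * y * (Xi A x)\<^sup>2))
              * exp (- z * y * Xi A x) * F x
          - b2 t * ((1 + z * y * Xi A x) / (y * (Xi A x)\<^sup>2)) * exp (- z * y * Xi A x) * F x \<and>
        poisson_bracket A snd (deformed_ham A F b1 b2 z t) (x, y) =
          a x * y\<^sup>2
          + b1 t * exp (- z * y * Xi A x)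
              * ((exp (z * y * Xi A x) - 1) / (z * Xi A x)
                 + (exp (z * y * Xi A x) - 1 - z * y * Xi A x) / (z * (Xi A x)\<^sup>2) * a x * F x)
          - b2 t * (exp (- z * y * Xi A x) / (Xi A x)\<^sup>2)
              * (Xi A x + (1 + z * y * Xi A x) * a x * F x))"
proof (intro conjI; (intro ballI allI impI)?)
  show "buch_ham A F b1 b2 t P =
      (\<lambda>Q. osc1 Q + b1 t * osc2 Q + b2 t * osc3 Q) (can_coords A F P) \<and>
    ((\<lambda>w. deformed_ham A F b1 b2 w t P) \<longlongrightarrow> buch_ham A F b1 b2 t P) (at 0)"
    if "P \<in> phase_space I" for t P
    using that tendsto_deformed_ham[of P]
    by (auto simp: phase_space_def buch_ham_def buch1_def buch2_def buch3_def osc1_def osc2_def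
        osc3_def can_coords_def)
  show "deformed_ham A F b1 b2 z t P = hz1 A F z P + b1 t * hz2 A F z P + b2 t * hz3 A F z P" for t P
    by (rule deformed_ham_eq)
  show "hz1 A F z (x, y) = y * Xi A x \<and>
      hz2 A F z (x, y) = (exp (- z * y * Xi A x) - 1) / (z * y * Xi A x) * F x \<and>
      hz3 A F z (x, y) = exp (- z * y * Xi A x) / (y * Xi A x) * F x \<and>
      hz0 A F z (x, y) = 1" for x y
    by (simp add: hz1_eq hz2_eq hz3_eq hz0_eq)
  show "poisson_bracket A (hz2 A F z) (hz1 A F z) P = (exp (- z * hz1 A F z P) - 1) / z \<and>
      poisson_bracket A (hz2 A F z) (hz3 A F z) P = hz3 A F z P \<and>
      poisson_bracket A (hz3 A F z) (hz1 A F z) P = exp (- z * hz1 A F z P) * hz0 A F z P \<and>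
      (\<forall>f. f differentiable_on phase_space I \<longrightarrow> poisson_bracket A (hz0 A F z) f P = 0)"
    if P: "P \<in> phase_space I" for P
  proof -
    obtain x y where xy: "P = (x, y)" "x \<in> I" "y \<noteq> 0"
      using P by (auto simp: phase_space_def)
    then have AF: "(A has_real_derivative a x) (at x)" "(F has_real_derivative Xi A x) (at x)"
      using A F by auto
    show ?thesis
      \<comment> \<open>\<open>hz0\<close> is the constant 1, so each product in its bracket with f
        has a vanishing factor; it also supplies the factor 1 in the third bracket.\<close>
      using brackets_hz[OF AF xy(3) \<open>z \<noteq> 0\<close>] unfolding xy(1)
      by (auto simp: hz0_eq poisson_bracket_def)
  qed
  show "hamilton_solution (omega A) (deformed_ham A F b1 b2 z) T (\<lambda>t. (x t, y t)) \<longleftrightarrow>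
      (\<forall>t\<in>T.
        (x has_real_derivative poisson_bracket A fst (deformed_ham A F b1 b2 z t) (x t, y t)) (at t) \<and>
        (y has_real_derivative poisson_bracket A snd (deformed_ham A F b1 b2 z t) (x t, y t)) (at t))"
    if T: "open T \<and> is_interval T \<and> T \<subseteq> J \<and> (\<forall>t\<in>T. (x t, y t) \<in> phase_space I)" for T x y
  proof (rule hamilton_solution_omega_iff)
    fix t assume "t \<in> T"
    then have xy: "x t \<in> I" "y t \<noteq> 0" using T by (auto simp: phase_space_def)
    then show "y t \<noteq> 0" by simp
    \<comment> \<open>Along the curve x t lies in \<open>I\<close> and y t \<noteq> 0, so the
      explicit total derivative is available at each of its points.\<close>
    show "deformed_ham A F b1 b2 z t differentiable (at (x t, y t))"
      using has_derivative_deformed_ham[OF A[rule_format] F[rule_format] _ \<open>z \<noteq> 0\<close>] xy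
      unfolding differentiable_def by blast
  qed
  fix t x y :: real
  assume x: "x \<in> I" and y: "y \<noteq> 0"
  note D = has_derivative_deformed_ham[OF A[rule_format, OF x] F[rule_format, OF x] y \<open>z \<noteq> 0\<close>,
      of b1 b2 t]
  show "poisson_bracket A fst (deformed_ham A F b1 b2 z t) (x, y) =
      y
      + b1 t * ((exp (z * y * Xi A x) - 1 - z * y * Xi A x) / (z * y * (Xi A x)\<^sup>2))
          * exp (- z * y * Xi A x) * F x
      - b2 t * ((1 + z * y * Xi A x) / (y * (Xi A x)\<^sup>2)) * exp (- z * y * Xi A x) * F x \<and>
    poisson_bracket A snd (deformed_ham A F b1 b2 z t) (x, y) =
      a x * y\<^sup>2
      + b1 t * exp (- z * y * Xi A x)
          * ((exp (z * y * Xi A x) - 1) / (z * Xi A x)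
             + (exp (z * y * Xi A x) - 1 - z * y * Xi A x) / (z * (Xi A x)\<^sup>2) * a x * F x)
      - b2 t * (exp (- z * y * Xi A x) / (Xi A x)\<^sup>2)
          * (Xi A x + (1 + z * y * Xi A x) * a x * F x)"
    \<comment> \<open>The gradient contains only exp (- z r), while the stated equations mix exp (z
      r) and exp (- z r); \<open>exp_minus\<close> reduces everything to the single nonzero quantity
      exp (z r) before denominators are cleared.\<close>
    unfolding poisson_bracket_coordinates[OF D]
    using y \<open>z \<noteq> 0\<close> by (simp add: exp_minus field_simps power2_eq_square)
qed

end
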